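(* Let $n\ge 1$ and let $i,j$ be integers with $0\le i\le j\le n$ and $\frac{i}{2}+j>n$. If $f\in U_{[i,j]}(n,3)$ and $f\not\equiv 0$, then $$|f|\ge 2^{i+j-n}\cdot 3^{n-j}.$$ Moreover, this bound is sharp: for all such $n,i,j$ there exists $f\in U_{[i,j]}(n,3)$, $f\not\equiv 0$, with $|f|=2^{i+j-n}\cdot 3^{n-j}$.
   Context: For $q\ge 2$ let $\Sigma_q=\{0,1,\ldots,q-1\}$. The Hamming graph $H(n,q)$ has vertex set $\Sigma_q^n$, and two vertices are adjacent if they differ in exactly one coordinate. The eigenvalues of its adjacency matrix are $\lambda_i(n,q)=n(q-1)-q\cdot i$ for $0\le i\le n$. Let $U_i(n,q)$ be the $\lambda_i(n,q)$-eigenspace, i.e. the space of functions $f:\Sigma_q^n\to\mathbb{R}$ with $\lambda_i(n,q)f(x)=\sum_{y\in N(x)}f(y)$ for every vertex $x$, where $N(x)$ is the set of neighbors of $x$. For $0\le i\le j\le n$ let $U_{[i,j]}(n,q)=U_i(n,q)\oplus U_{i+1}(n,q)\oplus\cdots\oplus U_j(n,q)$. For a function $f:\Sigma_q^n\to\mathbb{R}$, $|f|$ denotes the cardinality of its support $\{x : f(x)\ne 0\}$. *)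

theory Defs
  imports Complex_Main
begin

(* Words over the alphabet {0, ..., q-1} are lists of natural numbers, so that the
   dimension n is an ordinary term. *)
definition hamming_verts :: "nat \<Rightarrow> nat \<Rightarrow> nat list set" where
  "hamming_verts n q = {x. length x = n \<and> set x \<subseteq> {0..<q}}"

definition hamming_nbrs :: "nat \<Rightarrow> nat \<Rightarrow> nat list \<Rightarrow> nat list set" where
  "hamming_nbrs n q x = {y \<in> hamming_verts n q. card {k. k < n \<and> x ! k \<noteq> y ! k} = 1}"

definition hamming_eigval :: "nat \<Rightarrow> nat \<Rightarrow> nat \<Rightarrow> real" where
  "hamming_eigval n q i = real n * (real q - 1) - real q * real i"

(* A real function on the vertex set is represented by its extension by zero to all lists,
   so equality of represented functions is equality in HOL. *)
definition vertex_funs :: "nat \<Rightarrow> nat \<Rightarrow> (nat list \<Rightarrow> real) set" where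
  "vertex_funs n q = {f. \<forall>x. x \<notin> hamming_verts n q \<longrightarrow> f x = 0}"

definition hamming_eigenspace :: "nat \<Rightarrow> nat \<Rightarrow> nat \<Rightarrow> (nat list \<Rightarrow> real) set" where
  "hamming_eigenspace n q i =
     {f \<in> vertex_funs n q. \<forall>x \<in> hamming_verts n q.
        hamming_eigval n q i * f x = (\<Sum>y\<in>hamming_nbrs n q x. f y)}"

(* The sum of the eigenspaces; it is direct for q \<ge> 1, because the eigenvalues are then
   pairwise distinct. *)
definition hamming_eigensum :: "nat \<Rightarrow> nat \<Rightarrow> nat \<Rightarrow> nat \<Rightarrow> (nat list \<Rightarrow> real) set" where
  "hamming_eigensum n q i j =
     {f. \<exists>g. (\<forall>k\<in>{i..j}. g k \<in> hamming_eigenspace n q k) \<and> f = (\<lambda>x. \<Sum>k=i..j. g k x)}"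

definition supp_size :: "nat \<Rightarrow> nat \<Rightarrow> (nat list \<Rightarrow> real) \<Rightarrow> nat" where
  "supp_size n q f = card {x \<in> hamming_verts n q. f x \<noteq> 0}"

end

theory Submission
  imports Defs
begin

text \<open>
  The lower bound comes from cutting a function on \<open>H(n+1,3)\<close> into its three slices
  \<open>x \<mapsto> f (a # x)\<close>.  Since \<open>H(n+1,q)\<close> is the Cartesian product of a complete graph with
  \<open>H(n,q)\<close>, the slices of an eigenfunction of weight \<open>l\<close>, that is, with eigenvalue
  \<open>(n + 1)(q - 1) - q l\<close>, are again controlled: their sum over all letters has weight \<open>l\<close>, and
  every difference of two of them has weight \<open>l - 1\<close>; hence a single slice is a mixture
  of weights \<open>l - 1\<close> and \<open>l\<close> (\<open>contract_spectral_sum\<close>).  Let \<open>f\<close> be nonzero with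
  weights in \<open>{i..j}\<close>.

  \<^item> If three slices are nonzero, each of them has weights in \<open>{i - 1..j}\<close>.
  \<^item> If two are nonzero, each of them is its difference with the vanishing slice and has weights
    in \<open>{i - 1..j - 1}\<close>.
  \<^item> If only one is nonzero, it is in addition the sum of all slices, and as eigenspaces are
    independent its weights lie in \<open>{i..j} \<inter> {i - 1..j - 1} = {i..j - 1}\<close>.

  The quantity \<open>2\<^sup>i (3/2)\<^sup>n\<^sup>-\<^sup>j\<close> is divided by exactly 3, 2 and 1 when \<open>(n + 1, i, j)\<close> is
  replaced by the parameters of these three cases in dimension \<open>n\<close>, so it bounds the support from
  below by induction on the dimension (\<open>supp_size_bound\<close>).

  Extremal functions are tensor products of three kinds of factors: the Vandermonde product in
  three coordinates (pure weight 2, support of size 6), the difference of two point masses in one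
  coordinate (weight 1, support 2), and a point mass in one coordinate (weights 0 and 1,
  support 1).  They are used \<open>n - j\<close>, \<open>i - 2 (n - j)\<close> and \<open>j - i\<close> times, respectively;
  the second number is where \<open>i / 2 + j > n\<close> enters.\<close>

section \<open>Neighbour sums and the first letter\<close>

definition nbr_sum :: "nat \<Rightarrow> nat \<Rightarrow> (nat list \<Rightarrow> real) \<Rightarrow> nat list \<Rightarrow> real" where
  "nbr_sum n q f x = (\<Sum>y\<in>hamming_nbrs n q x. f y)"

lemma hamming_verts_0: "hamming_verts 0 q = {[]}"
  by (auto simp: hamming_verts_def)

lemma Nil_notin_hamming_verts_Suc: "[] \<notin> hamming_verts (Suc n) q"
  by (simp add: hamming_verts_def)

lemma Cons_in_hamming_verts:
  "a # x \<in> hamming_verts (Suc n) q \<longleftrightarrow> a < q \<and> x \<in> hamming_verts n q"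
  by (auto simp: hamming_verts_def)

lemma hamming_verts_Suc:
  "hamming_verts (Suc n) q = (\<lambda>(a, x). a # x) ` ({..<q} \<times> hamming_verts n q)"
proof (rule set_eqI)
  fix x show "x \<in> hamming_verts (Suc n) q \<longleftrightarrow>
      x \<in> (\<lambda>(a, x). a # x) ` ({..<q} \<times> hamming_verts n q)"
    by (cases x) (auto simp: Cons_in_hamming_verts Nil_notin_hamming_verts_Suc)
qed

lemma finite_hamming_verts: "finite (hamming_verts n q)"
  by (induction n) (simp_all add: hamming_verts_0 hamming_verts_Suc)

lemma finite_hamming_nbrs: "finite (hamming_nbrs n q x)"
  using finite_hamming_verts by (simp add: hamming_nbrs_def)

lemma nbr_sum_0: "nbr_sum 0 q f x = 0"
  by (simp add: nbr_sum_def hamming_nbrs_def)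

lemma card_differing_Cons:
  "card {k. k < Suc n \<and> (a # x) ! k \<noteq> (b # y) ! k} =
     (if a = b then 0 else 1) + card {k. k < n \<and> x ! k \<noteq> y ! k}"
proof -
  have "{k. k < Suc n \<and> (a # x) ! k \<noteq> (b # y) ! k} =
      (if a = b then {} else {0}) \<union> Suc ` {k. k < n \<and> x ! k \<noteq> y ! k}" (is "?L = ?R")
  proof (rule set_eqI)
    fix k show "k \<in> ?L \<longleftrightarrow> k \<in> ?R" by (cases k) auto
  qed
  then show ?thesis
    by (subst \<open>?L = ?R\<close>, subst card_Un_disjoint) (auto simp: card_image)
qed

lemma card_differing_eq_0_iff:
  assumes "x \<in> hamming_verts n q" and "y \<in> hamming_verts n q"
  shows "card {k. k < n \<and> x ! k \<noteq> y ! k} = 0 \<longleftrightarrow> x = y"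
  using assms by (auto simp: hamming_verts_def intro: nth_equalityI)

lemma hamming_nbrs_Cons:
  assumes "a < q" and x: "x \<in> hamming_verts n q"
  shows "hamming_nbrs (Suc n) q (a # x) =
    Cons a ` hamming_nbrs n q x \<union> (\<lambda>m. m # x) ` ({..<q} - {a})" (is "?L = ?R")
proof (rule set_eqI)
  fix z show "z \<in> ?L \<longleftrightarrow> z \<in> ?R"
  proof (cases z)
    case Nil
    then show ?thesis by (auto simp: hamming_nbrs_def Nil_notin_hamming_verts_Suc)
  next
    case (Cons b y)
    show ?thesis
      using assms card_differing_eq_0_iff[OF x, of y]
      unfolding Cons hamming_nbrs_def mem_Collect_eq Cons_in_hamming_verts card_differing_Cons
      by (auto simp: image_iff)
  qed
qed

text \<open>
  \<open>H(n+1,q)\<close> is the Cartesian product of the complete graph on the letters with \<open>H(n,q)\<close>,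
  so the neighbour sum splits into changes of the tail and changes of the first letter.\<close>

lemma nbr_sum_Cons:
  assumes "a < q" and "x \<in> hamming_verts n q"
  shows "nbr_sum (Suc n) q f (a # x) =
    nbr_sum n q (\<lambda>y. f (a # y)) x + (\<Sum>m<q. f (m # x)) - f (a # x)"
proof -
  have "x \<notin> hamming_nbrs n q x" by (simp add: hamming_nbrs_def)
  then have "nbr_sum (Suc n) q f (a # x) =
      sum f (Cons a ` hamming_nbrs n q x) + sum f ((\<lambda>m. m # x) ` ({..<q} - {a}))"
    unfolding nbr_sum_def hamming_nbrs_Cons[OF assms]
    by (intro sum.union_disjoint) (auto simp: finite_hamming_nbrs)
  also have "\<dots> = nbr_sum n q (\<lambda>y. f (a # y)) x + (\<Sum>m\<in>{..<q} - {a}. f (m # x))"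
    by (simp add: nbr_sum_def sum.reindex inj_on_def)
  also have "(\<Sum>m\<in>{..<q} - {a}. f (m # x)) = (\<Sum>m<q. f (m # x)) - f (a # x)"
    using assms by (subst sum_diff1) auto
  finally show ?thesis by simp
qed

lemma nbr_sum_sum:
  "nbr_sum n q (\<lambda>y. \<Sum>k\<in>K. g k y) x = (\<Sum>k\<in>K. nbr_sum n q (g k) x)"
  unfolding nbr_sum_def by (rule sum.swap)

lemma nbr_sum_scale: "nbr_sum n q (\<lambda>y. c * f y) x = c * nbr_sum n q f x"
  by (simp add: nbr_sum_def sum_distrib_left)

lemma nbr_sum_add: "nbr_sum n q (\<lambda>y. f y + g y) x = nbr_sum n q f x + nbr_sum n q g x"
  by (simp add: nbr_sum_def sum.distrib)

section \<open>Eigenspaces with integer index and their sums\<close>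

text \<open>
  The index is an integer, so that shifting weights by one never has to be guarded at the
  ends of \<open>{0..n}\<close>.  For \<open>q \<ge> 1\<close> the spaces with index outside this range are trivial.\<close>

definition weight_space :: "nat \<Rightarrow> nat \<Rightarrow> int \<Rightarrow> (nat list \<Rightarrow> real) set" where
  "weight_space n q l = {f \<in> vertex_funs n q. \<forall>x \<in> hamming_verts n q.
     nbr_sum n q f x = (real n * (real q - 1) - real q * of_int l) * f x}"

definition spectral_sum :: "nat \<Rightarrow> nat \<Rightarrow> int set \<Rightarrow> (nat list \<Rightarrow> real) set" where
  "spectral_sum n q K =
     {f. \<exists>g. (\<forall>k\<in>K. g k \<in> weight_space n q k) \<and> f = (\<lambda>x. \<Sum>k\<in>K. g k x)}"

lemma weight_space_of_nat: "weight_space n q (int l) = hamming_eigenspace n q l"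
  by (auto simp: weight_space_def hamming_eigenspace_def nbr_sum_def hamming_eigval_def)

lemma hamming_eigensum_eq_spectral_sum:
  "hamming_eigensum n q i j = spectral_sum n q {int i..int j}"
proof -
  have sum_int: "(\<Sum>k\<in>{int i..int j}. h k) = (\<Sum>k=i..j. h (int k))" for h :: "int \<Rightarrow> real"
    by (simp add: sum.reindex flip: image_int_atLeastAtMost)
  have ball_int: "(\<forall>k\<in>{int i..int j}. P k) \<longleftrightarrow> (\<forall>k\<in>{i..j}. P (int k))" for P
    by (simp flip: image_int_atLeastAtMost)
  show ?thesis
  proof (intro equalityI subsetI)
    fix f assume "f \<in> hamming_eigensum n q i j"
    then obtain g where "\<forall>k\<in>{i..j}. g k \<in> hamming_eigenspace n q k" "f = (\<lambda>x. \<Sum>k=i..j. g k x)"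
      by (auto simp: hamming_eigensum_def)
    then show "f \<in> spectral_sum n q {int i..int j}"
      unfolding spectral_sum_def mem_Collect_eq sum_int ball_int weight_space_of_nat
      by (intro exI[of _ "\<lambda>k. g (nat k)"]) simp
  next
    fix f assume "f \<in> spectral_sum n q {int i..int j}"
    then obtain g where "\<forall>k\<in>{i..j}. g (int k) \<in> hamming_eigenspace n q k"
        "f = (\<lambda>x. \<Sum>k=i..j. g (int k) x)"
      unfolding spectral_sum_def mem_Collect_eq sum_int ball_int weight_space_of_nat by blast
    then show "f \<in> hamming_eigensum n q i j"
      unfolding hamming_eigensum_def mem_Collect_eq by (intro exI[of _ "\<lambda>k. g (int k)"]) simp
  qed
qed

lemma zero_in_weight_space: "(\<lambda>x. 0) \<in> weight_space n q l"
  by (simp add: weight_space_def vertex_funs_def nbr_sum_def)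

lemma weight_space_scale: "f \<in> weight_space n q l \<Longrightarrow> (\<lambda>x. c * f x) \<in> weight_space n q l"
  by (auto simp: weight_space_def vertex_funs_def nbr_sum_scale)

lemma weight_space_add:
  "f \<in> weight_space n q l \<Longrightarrow> g \<in> weight_space n q l \<Longrightarrow>
    (\<lambda>x. f x + g x) \<in> weight_space n q l"
  by (simp add: weight_space_def vertex_funs_def nbr_sum_add distrib_left)

lemma weight_space_zero_outside:
  "f \<in> weight_space n q l \<Longrightarrow> x \<notin> hamming_verts n q \<Longrightarrow> f x = 0"
  by (simp add: weight_space_def vertex_funs_def)

lemma nbr_sum_weight_space:
  "f \<in> weight_space n q l \<Longrightarrow> x \<in> hamming_verts n q \<Longrightarrow>
    nbr_sum n q f x = (real n * (real q - 1) - real q * of_int l) * f x"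
  by (simp add: weight_space_def)

text \<open>
  Extending the family of components by zero makes families over different index sets
  comparable.\<close>

lemma spectral_sumE_zero_outside:
  assumes "f \<in> spectral_sum n q K"
  obtains g where "\<forall>k. g k \<in> weight_space n q k" "\<forall>k. k \<notin> K \<longrightarrow> g k = (\<lambda>x. 0)"
    "f = (\<lambda>x. \<Sum>k\<in>K. g k x)"
proof -
  from assms obtain g where g: "\<forall>k\<in>K. g k \<in> weight_space n q k" "f = (\<lambda>x. \<Sum>k\<in>K. g k x)"
    by (auto simp: spectral_sum_def)
  show ?thesis
    by (rule that[of "\<lambda>k. if k \<in> K then g k else (\<lambda>x. 0)"])
       (use g zero_in_weight_space in auto)
qed

lemma spectral_sumE:
  assumes "f \<in> spectral_sum n q K"
  obtains g where "\<forall>k. g k \<in> weight_space n q k" "f = (\<lambda>x. \<Sum>k\<in>K. g k x)"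
  using spectral_sumE_zero_outside[OF assms] that by blast

lemma spectral_sumI:
  "(\<And>k. k \<in> K \<Longrightarrow> g k \<in> weight_space n q k) \<Longrightarrow> (\<lambda>x. \<Sum>k\<in>K. g k x) \<in> spectral_sum n q K"
  by (auto simp: spectral_sum_def)

lemma spectral_sum_singleton: "spectral_sum n q {l} = weight_space n q l"
proof -
  have "f \<in> weight_space n q l \<Longrightarrow> \<exists>g. g l \<in> weight_space n q l \<and> f = g l" for f
    by (rule exI[of _ "\<lambda>k. f"]) simp
  then show ?thesis by (auto simp: spectral_sum_def)
qed

lemma spectral_sum_mono:
  assumes "K \<subseteq> L" and "finite L"
  shows "spectral_sum n q K \<subseteq> spectral_sum n q L"
proof
  fix f assume "f \<in> spectral_sum n q K"
  then obtain g where g: "\<forall>k. g k \<in> weight_space n q k" "\<forall>k. k \<notin> K \<longrightarrow> g k = (\<lambda>x. 0)"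
    "f = (\<lambda>x. \<Sum>k\<in>K. g k x)" by (rule spectral_sumE_zero_outside)
  have "f = (\<lambda>x. \<Sum>k\<in>L. g k x)"
    unfolding g(3) using assms g(2) by (intro ext sum.mono_neutral_left) auto
  then show "f \<in> spectral_sum n q L" using g(1) by (auto simp: spectral_sum_def)
qed

lemma spectral_sum_add:
  assumes "f \<in> spectral_sum n q K" "h \<in> spectral_sum n q K"
  shows "(\<lambda>x. f x + h x) \<in> spectral_sum n q K"
proof -
  obtain g where g: "\<forall>k. g k \<in> weight_space n q k" "f = (\<lambda>x. \<Sum>k\<in>K. g k x)"
    using assms(1) by (rule spectral_sumE)
  obtain g' where g': "\<forall>k. g' k \<in> weight_space n q k" "h = (\<lambda>x. \<Sum>k\<in>K. g' k x)"
    using assms(2) by (rule spectral_sumE)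
  have "(\<lambda>x. \<Sum>k\<in>K. g k x + g' k x) \<in> spectral_sum n q K"
    by (rule spectral_sumI) (intro weight_space_add g(1)[rule_format] g'(1)[rule_format])
  then show ?thesis by (simp add: g(2) g'(2) sum.distrib)
qed

lemma spectral_sum_zero_outside:
  "f \<in> spectral_sum n q K \<Longrightarrow> x \<notin> hamming_verts n q \<Longrightarrow> f x = 0"
  by (auto simp: spectral_sum_def intro!: sum.neutral weight_space_zero_outside)

text \<open>
  The operators that remove or add first letters are linear and shift weights, so their effect on a
  sum of eigenspaces can be read off from each eigenspace.\<close>

lemma spectral_sum_map:
  assumes f: "f \<in> spectral_sum n q K"
    and eig: "\<And>l g. g \<in> weight_space n q l \<Longrightarrow> T g \<in> weight_space n' q (s l)"
    and lin: "\<And>g x. T (\<lambda>x. \<Sum>k\<in>K. g k x) x = (\<Sum>k\<in>K. T (g k) x)"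
    and inj: "inj s"
  shows "T f \<in> spectral_sum n' q (s ` K)"
proof -
  obtain g where g: "\<forall>k. g k \<in> weight_space n q k" "f = (\<lambda>x. \<Sum>k\<in>K. g k x)"
    using f by (rule spectral_sumE)
  have inj': "inj_on s K" using inj by (rule inj_on_subset) simp
  have "T f = (\<lambda>x. \<Sum>l\<in>s ` K. T (g (inv s l)) x)"
    by (intro ext) (simp add: g(2) lin sum.reindex[OF inj'] inv_f_f[OF inj])
  moreover have "T (g (inv s l)) \<in> weight_space n' q l" if "l \<in> s ` K" for l
    using that eig[OF g(1)[rule_format]] by (auto simp: inv_f_f[OF inj])
  ultimately show ?thesis
    using spectral_sumI[of "s ` K" "\<lambda>l. T (g (inv s l))"] by simp
qed

text \<open>
  Eigenfunctions of distinct eigenvalues are linearly independent: applying the neighbour sum to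
  a relation and subtracting the multiple by one eigenvalue eliminates that term.\<close>

lemma weight_spaces_independent:
  assumes "finite K" and "q > 0"
    and "\<And>k. k \<in> K \<Longrightarrow> g k \<in> weight_space n q k"
    and "\<And>x. (\<Sum>k\<in>K. g k x) = 0"
    and "k \<in> K"
  shows "g k x = 0"
  using assms(1,3-5)
proof (induction K arbitrary: g k x rule: finite_induct)
  case empty
  then show ?case by simp
next
  case (insert a K)
  let ?ev = "\<lambda>k::int. real n * (real q - 1) - real q * of_int k"
  have ga: "g a x = - (\<Sum>k\<in>K. g k x)" for x
    using insert.prems(2)[of x] insert.hyps by simp
  have gK: "g k x = 0" if "k \<in> K" for k x
  proof -
    have "(?ev k - ?ev a) * g k x = 0"
    proof (rule insert.IH[where g = "\<lambda>k x. (?ev k - ?ev a) * g k x"])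
      show "(\<lambda>x. (?ev k - ?ev a) * g k x) \<in> weight_space n q k" if "k \<in> K" for k
        using insert.prems(1) that by (intro weight_space_scale) simp
      show "(\<Sum>k\<in>K. (?ev k - ?ev a) * g k x) = 0" for x
      proof (cases "x \<in> hamming_verts n q")
        case True
        have "0 = nbr_sum n q (\<lambda>y. \<Sum>k\<in>insert a K. g k y) x"
          using insert.prems(2) by (simp add: nbr_sum_def)
        also have "\<dots> = (\<Sum>k\<in>insert a K. nbr_sum n q (g k) x)"
          by (rule nbr_sum_sum)
        also have "\<dots> = (\<Sum>k\<in>insert a K. ?ev k * g k x)"
          using True insert.prems(1) by (intro sum.cong refl nbr_sum_weight_space)
        also have "\<dots> = ?ev a * g a x + (\<Sum>k\<in>K. ?ev k * g k x)"
          using insert.hyps by simp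
        also have "\<dots> = (\<Sum>k\<in>K. (?ev k - ?ev a) * g k x)"
          by (simp only: ga left_diff_distrib sum_subtractf sum_distrib_left[symmetric])
        finally show ?thesis by simp
      next
        case False
        then show ?thesis
          using weight_space_zero_outside[OF insert.prems(1)] by (simp add: sum.neutral)
      qed
    qed (fact that)
    moreover have "k \<noteq> a" using that insert.hyps by auto
    ultimately show ?thesis using \<open>q > 0\<close> by simp
  qed
  show ?case
  proof (cases "k = a")
    case True
    then show ?thesis using ga gK by simp
  next
    case False
    then show ?thesis using gK insert.prems(3) by simp
  qed
qed

lemma spectral_sum_Int:
  assumes "finite K" "finite L" "q > 0"
    and fK: "f \<in> spectral_sum n q K" and fL: "f \<in> spectral_sum n q L"
  shows "f \<in> spectral_sum n q (K \<inter> L)"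
proof -
  obtain g where g: "\<forall>k. g k \<in> weight_space n q k" "\<forall>k. k \<notin> K \<longrightarrow> g k = (\<lambda>x. 0)"
    "f = (\<lambda>x. \<Sum>k\<in>K. g k x)" using fK by (rule spectral_sumE_zero_outside)
  obtain h where h: "\<forall>k. h k \<in> weight_space n q k" "\<forall>k. k \<notin> L \<longrightarrow> h k = (\<lambda>x. 0)"
    "f = (\<lambda>x. \<Sum>k\<in>L. h k x)" using fL by (rule spectral_sumE_zero_outside)
  have fin: "finite (K \<union> L)" using assms by simp
  have g_all: "f x = (\<Sum>k\<in>K \<union> L. g k x)" for x
    unfolding g(3) using fin g(2) by (intro sum.mono_neutral_left) auto
  have h_all: "f x = (\<Sum>k\<in>K \<union> L. h k x)" for x
    unfolding h(3) using fin h(2) by (intro sum.mono_neutral_left) auto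
  have "g k x - h k x = 0" if "k \<in> K \<union> L" for k x
  proof (rule weight_spaces_independent[OF fin \<open>q > 0\<close>, where g = "\<lambda>k x. g k x - h k x"])
    show "(\<lambda>x. g k x - h k x) \<in> weight_space n q k" for k
      using weight_space_add[OF g(1)[rule_format] weight_space_scale[OF h(1)[rule_format], where c = "-1"]] by simp
    show "(\<Sum>k\<in>K \<union> L. g k x - h k x) = 0" for x
      using g_all[of x] h_all[of x] by (simp add: sum_subtractf)
  qed (fact that)
  then have "g k = (\<lambda>x. 0)" if "k \<in> K - L" for k
    using h(2)[rule_format, of k] that by fastforce
  then have "f = (\<lambda>x. \<Sum>k\<in>K \<inter> L. g k x)"
    unfolding g(3) using assms(1) by (intro ext sum.mono_neutral_right) auto
  then show ?thesis using g(1) by (simp add: spectral_sumI)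
qed

section \<open>Contracting the first letter\<close>

text \<open>
  Linear combinations of the slices treat single slices, differences and the total uniformly.\<close>

definition contract :: "nat \<Rightarrow> (nat \<Rightarrow> real) \<Rightarrow> (nat list \<Rightarrow> real) \<Rightarrow> nat list \<Rightarrow> real" where
  "contract q c f x = (\<Sum>m<q. c m * f (m # x))"

text \<open>
  The correction \<open>(\<Sum>m<q. c m) * (\<Sum>m<q. f (m # x))\<close> is a multiple of the contraction in two
  situations: it vanishes when \<open>c\<close> sums to zero, and it is \<open>q\<close> times the contraction when \<open>c\<close>
  is constant.  The eigenvalue on \<open>H(n,q)\<close> is then that of weight \<open>l - 1\<close> or \<open>l\<close>.\<close>

lemma nbr_sum_contract:
  assumes f: "f \<in> weight_space (Suc n) q l" and x: "x \<in> hamming_verts n q"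
  shows "nbr_sum n q (contract q c f) x =
    (real (Suc n) * (real q - 1) - real q * of_int l + 1) * contract q c f x
      - (\<Sum>m<q. c m) * (\<Sum>m<q. f (m # x))"
proof -
  let ?ev = "real (Suc n) * (real q - 1) - real q * of_int l"
  define S where "S = (\<Sum>m<q. f (m # x))"
  have slice: "nbr_sum n q (\<lambda>y. f (m # y)) x = (?ev + 1) * f (m # x) - S"
    if "m < q" for m
    using nbr_sum_Cons[OF that x, of f] nbr_sum_weight_space[OF f, of "m # x"] that x
    by (simp add: S_def Cons_in_hamming_verts algebra_simps)
  have "nbr_sum n q (contract q c f) x = (\<Sum>m<q. c m * nbr_sum n q (\<lambda>y. f (m # y)) x)"
    unfolding contract_def[abs_def] nbr_sum_sum nbr_sum_scale ..
  also have "\<dots> = (\<Sum>m<q. (?ev + 1) * (c m * f (m # x)) - c m * S)"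
    by (intro sum.cong refl) (simp add: slice right_diff_distrib)
  also have "\<dots> = (?ev + 1) * contract q c f x - (\<Sum>m<q. c m) * S"
    by (simp only: sum_subtractf sum_distrib_left sum_distrib_right contract_def)
  finally show ?thesis unfolding S_def .
qed

lemma contract_in_vertex_funs:
  "f \<in> weight_space (Suc n) q l \<Longrightarrow> contract q c f \<in> vertex_funs n q"
  by (auto simp: vertex_funs_def contract_def Cons_in_hamming_verts weight_space_zero_outside
      intro!: sum.neutral)

lemma contract_weight_space_sum_zero:
  assumes "f \<in> weight_space (Suc n) q l" and "(\<Sum>m<q. c m) = 0"
  shows "contract q c f \<in> weight_space n q (l - 1)"
proof -
  have "nbr_sum n q (contract q c f) x =
      (real n * (real q - 1) - real q * of_int (l - 1)) * contract q c f x"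
    if "x \<in> hamming_verts n q" for x
    using nbr_sum_contract[OF assms(1) that, of c] assms(2) by (simp add: algebra_simps)
  then show ?thesis
    using contract_in_vertex_funs[OF assms(1)] by (simp add: weight_space_def)
qed

lemma contract_weight_space_const:
  assumes "f \<in> weight_space (Suc n) q l"
  shows "contract q (\<lambda>m. c) f \<in> weight_space n q l"
proof -
  have "contract q (\<lambda>m. c) f x = c * (\<Sum>m<q. f (m # x))" for x
    by (simp add: contract_def sum_distrib_left)
  then have "nbr_sum n q (contract q (\<lambda>m. c) f) x =
      (real n * (real q - 1) - real q * of_int l) * contract q (\<lambda>m. c) f x"
    if "x \<in> hamming_verts n q" for x
    using nbr_sum_contract[OF assms that, of "\<lambda>m. c"] by (simp add: algebra_simps)
  then show ?thesis
    using contract_in_vertex_funs[OF assms] by (simp add: weight_space_def)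
qed

lemma contract_sum:
  "contract q c (\<lambda>x. \<Sum>k\<in>K. g k x) x = (\<Sum>k\<in>K. contract q c (g k) x)"
  unfolding contract_def by (subst sum.swap) (simp add: sum_distrib_left)

lemma contract_sum_zero:
  assumes "f \<in> spectral_sum (Suc n) q K" and "(\<Sum>m<q. c m) = 0"
  shows "contract q c f \<in> spectral_sum n q ((\<lambda>k. k - 1) ` K)"
  by (rule spectral_sum_map[OF assms(1)])
     (simp_all add: contract_weight_space_sum_zero assms(2) contract_sum inj_def)

lemma contract_const:
  assumes "f \<in> spectral_sum (Suc n) q K"
  shows "contract q (\<lambda>m. c) f \<in> spectral_sum n q K"
  using spectral_sum_map[OF assms, of "contract q (\<lambda>m. c)" n "\<lambda>k. k"]
  by (simp add: contract_weight_space_const contract_sum)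

text \<open>Split the coefficients \<open>c\<close> into their mean and a part with sum zero.\<close>

lemma contract_spectral_sum:
  assumes "f \<in> spectral_sum (Suc n) q K" and "finite K" and "q > 0"
  shows "contract q c f \<in> spectral_sum n q (K \<union> (\<lambda>k. k - 1) ` K)"
proof -
  define mean where "mean = (\<Sum>m<q. c m) / real q"
  have "contract q c f = (\<lambda>x. contract q (\<lambda>m. mean) f x + contract q (\<lambda>m. c m - mean) f x)"
    by (intro ext) (simp add: contract_def left_diff_distrib flip: sum.distrib)
  moreover have "contract q (\<lambda>m. mean) f \<in> spectral_sum n q (K \<union> (\<lambda>k. k - 1) ` K)"
    using contract_const[OF assms(1)] spectral_sum_mono[of K] assms(2) by blast
  moreover have "(\<Sum>m<q. c m - mean) = 0"
    using \<open>q > 0\<close> by (simp add: sum_subtractf mean_def)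
  then have "contract q (\<lambda>m. c m - mean) f \<in> spectral_sum n q (K \<union> (\<lambda>k. k - 1) ` K)"
    using contract_sum_zero[OF assms(1)] spectral_sum_mono[of "(\<lambda>k. k - 1) ` K"] assms(2)
    by blast
  ultimately show ?thesis using spectral_sum_add by simp
qed

lemma contract_letter:
  assumes "a < q"
  shows "contract q (\<lambda>m. of_bool (m = a)) f = (\<lambda>x. f (a # x))"
  using assms by (intro ext) (simp add: contract_def of_bool_def if_distrib[of "\<lambda>c. c * _"] cong: if_cong)

lemma slice_in_spectral_sum:
  assumes "f \<in> spectral_sum (Suc n) q {i..j}" and "a < q"
  shows "(\<lambda>x. f (a # x)) \<in> spectral_sum n q {i - 1..j}"
proof -
  have "(\<lambda>x. f (a # x)) \<in> spectral_sum n q ({i..j} \<union> {i - 1..j - 1})"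
    using contract_spectral_sum[OF assms(1), of "\<lambda>m. of_bool (m = a)"] assms(2)
    by (simp add: contract_letter)
  then show ?thesis using spectral_sum_mono[of "{i..j} \<union> {i - 1..j - 1}" "{i - 1..j}"] by auto
qed

lemma slice_diff_in_spectral_sum:
  assumes "f \<in> spectral_sum (Suc n) q {i..j}" and "a < q" and "b < q"
  shows "(\<lambda>x. f (a # x) - f (b # x)) \<in> spectral_sum n q {i - 1..j - 1}"
proof -
  have "contract q (\<lambda>m. of_bool (m = a) - of_bool (m = b)) f = (\<lambda>x. f (a # x) - f (b # x))"
    unfolding contract_letter[OF assms(2), of f, THEN fun_cong, symmetric]
      contract_letter[OF assms(3), of f, THEN fun_cong, symmetric]
    by (simp add: contract_def[abs_def] left_diff_distrib sum_subtractf)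
  moreover have "(\<Sum>m<q. of_bool (m = a) - of_bool (m = b) :: real) = 0"
    using assms(2,3) by (simp add: sum_subtractf of_bool_def)
  ultimately show ?thesis
    using contract_sum_zero[OF assms(1), of "\<lambda>m. of_bool (m = a) - of_bool (m = b)"]
    by simp
qed

lemma slice_sum_in_spectral_sum:
  assumes "f \<in> spectral_sum (Suc n) q K"
  shows "(\<lambda>x. \<Sum>m<q. f (m # x)) \<in> spectral_sum n q K"
  using contract_const[OF assms, of 1] by (simp add: contract_def[abs_def])

section \<open>The lower bound\<close>

lemma supp_size_Suc: "supp_size (Suc n) q f = (\<Sum>a<q. supp_size n q (\<lambda>x. f (a # x)))"
proof -
  have "{x \<in> hamming_verts (Suc n) q. f x \<noteq> 0} =
      (\<lambda>(a, x). a # x) ` (SIGMA a:{..<q}. {x \<in> hamming_verts n q. f (a # x) \<noteq> 0})"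
    by (auto simp: hamming_verts_Suc)
  moreover have "inj_on (\<lambda>(a, x). a # x) A" for A :: "(nat \<times> nat list) set"
    by (auto simp: inj_on_def)
  ultimately show ?thesis
    by (simp add: supp_size_def card_image card_SigmaI finite_hamming_verts)
qed

text \<open>
  The one-vertex graph carries only weight 0, hence \<open>i \<le> 0 \<le> j\<close>, and the bound is at most 1.\<close>

lemma supp_size_bound_0:
  assumes "f \<in> spectral_sum 0 3 {i..j}" and "f \<noteq> (\<lambda>x. 0)"
  shows "2 powi i * (3 / 2) powi (- j) \<le> real (supp_size 0 3 f)"
proof -
  obtain g where g: "\<forall>k. g k \<in> weight_space 0 3 k" "f = (\<lambda>x. \<Sum>k=i..j. g k x)"
    using assms(1) by (rule spectral_sumE)
  have f: "f [] \<noteq> 0"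
  proof
    assume "f [] = 0"
    then have "f x = 0" for x
      using spectral_sum_zero_outside[OF assms(1), of x]
      by (cases "x = []") (simp_all add: hamming_verts_0)
    then show False using assms(2) by auto
  qed
  then obtain k where k: "k \<in> {i..j}" "g k [] \<noteq> 0"
    unfolding g(2) by (meson sum.not_neutral_contains_not_neutral)
  have "k = 0"
    using nbr_sum_weight_space[OF g(1)[rule_format, of k], of "[]"] k(2)
    by (simp add: nbr_sum_0 hamming_verts_0)
  then have ij: "i \<le> 0" "0 \<le> j" using k(1) by auto
  have "(2::real) powi i \<le> 1" and "(3 / 2 :: real) powi (- j) \<le> 1"
    using power_int_increasing[of i 0 "2::real"] power_int_increasing[of "- j" 0 "3 / 2 :: real"] ij
    by simp_all
  then have "2 powi i * (3 / 2) powi (- j) \<le> 1 * (1::real)"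
    by (intro mult_mono) auto
  moreover have "supp_size 0 3 f = 1"
    using f by (simp add: supp_size_def hamming_verts_0 Collect_conv_if)
  ultimately show ?thesis by simp
qed

text \<open>
  With integer exponents the bound scales exactly in the three cases for the number of nonzero
  slices, even when \<open>i\<close> becomes negative or \<open>j\<close> exceeds the dimension, so the induction has no
  boundary cases.\<close>

lemma supp_size_bound:
  assumes "f \<in> spectral_sum n 3 {i..j}" and "f \<noteq> (\<lambda>x. 0)"
  shows "2 powi i * (3 / 2) powi (int n - j) \<le> real (supp_size n 3 f)"
  using assms
proof (induction n arbitrary: f i j)
  case 0
  then show ?case using supp_size_bound_0 by simp
next
  case (Suc n)
  define B :: real where "B = 2 powi i * (3 / 2) powi (int (Suc n) - j)"
  define s where "s a = (\<lambda>x. f (a # x))" for a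
  define Z where "Z = {a \<in> {..<3}. s a \<noteq> (\<lambda>x. 0)}"
  have Z: "finite Z" "Z \<subseteq> {..<3}" by (auto simp: Z_def)
  have "Z \<noteq> {}"
  proof
    assume empty: "Z = {}"
    have "f x = 0" for x
    proof (cases "x \<in> hamming_verts (Suc n) 3")
      case True
      then obtain a y where "x = a # y" "a < 3" by (auto simp: hamming_verts_Suc)
      then show ?thesis using empty by (auto simp: Z_def s_def dest!: fun_cong[of _ _ y])
    qed (use Suc.prems(1) spectral_sum_zero_outside in blast)
    then show False using Suc.prems(2) by auto
  qed
  have slice: "s a \<in> spectral_sum n 3 {i - 1..j}" if "a \<in> Z" for a
    using slice_in_spectral_sum[OF Suc.prems(1)] that by (auto simp: s_def Z_def)
  have slice': "s a \<in> spectral_sum n 3 {i - 1..j - 1}" if "a \<in> Z" "b \<in> {..<3} - Z" for a b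
  proof -
    have "f (b # x) = 0" for x using that by (auto simp: Z_def s_def dest: fun_cong)
    then show ?thesis
      using slice_diff_in_spectral_sum[OF Suc.prems(1), of a b] that by (simp add: s_def Z_def)
  qed
  \<comment> \<open>Each nonzero slice carries at least its equal share of the bound.\<close>
  have "B / card Z \<le> supp_size n 3 (s a)" if a: "a \<in> Z" for a
  proof -
    have exponent: "int n - (j - 1) = int (Suc n) - j" by simp
    have nz: "s a \<noteq> (\<lambda>x. 0)" using a by (simp add: Z_def)
    have "card Z \<le> 3" using card_mono[OF _ Z(2)] by simp
    moreover have "card Z \<noteq> 0" using \<open>Z \<noteq> {}\<close> Z by simp
    ultimately consider "card Z = 3" | "card Z = 2" | "card Z = 1" by linarith
    then show ?thesis
    proof cases
      case 1
      have "B / 3 = 2 powi (i - 1) * (3 / 2) powi (int n - j)"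
        by (simp add: B_def power_int_diff power_int_add)
      then show ?thesis using Suc.IH[OF slice[OF a] nz] 1 by simp
    next
      case 2
      then have "Z \<noteq> {..<3}" by auto
      then obtain b where b: "b \<in> {..<3} - Z" using Z by auto
      have "B / 2 = 2 powi (i - 1) * (3 / 2) powi (int n - (j - 1))"
        unfolding exponent by (simp add: B_def power_int_diff[of 2 i])
      then show ?thesis using Suc.IH[OF slice'[OF a b] nz] 2 by simp
    next
      case 3
      then have Za: "Z = {a}" using a by (metis card_1_singletonE singletonD)
      have "Z \<noteq> {..<3}" using 3 by auto
      then obtain b where b: "b \<in> {..<3} - Z" using Z by auto
      have "(\<Sum>m<3. f (m # x)) = (\<Sum>m\<in>Z. f (m # x))" for x
        by (rule sum.mono_neutral_right) (auto simp: Z_def s_def dest: fun_cong)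
      then have "s a \<in> spectral_sum n 3 {i..j}"
        using slice_sum_in_spectral_sum[OF Suc.prems(1)] by (simp add: Za s_def)
      then have "s a \<in> spectral_sum n 3 ({i..j} \<inter> {i - 1..j - 1})"
        using slice'[OF a b] by (intro spectral_sum_Int) auto
      moreover have "{i..j} \<inter> {i - 1..j - 1} = {i..j - 1}" by auto
      ultimately have "s a \<in> spectral_sum n 3 {i..j - 1}" by simp
      then show ?thesis
        using Suc.IH[of "s a" i "j - 1", unfolded exponent] nz 3 by (simp only: B_def) simp
    qed
  qed
  then have "real (card Z) * (B / card Z) \<le> (\<Sum>a\<in>Z. real (supp_size n 3 (s a)))"
    by (rule sum_bounded_below)
  also have "\<dots> \<le> (\<Sum>a<3. real (supp_size n 3 (s a)))"
    using Z by (intro sum_mono2) auto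
  also have "\<dots> = real (supp_size (Suc n) 3 f)"
    by (simp add: supp_size_Suc s_def)
  finally have "real (card Z) * (B / card Z) \<le> real (supp_size (Suc n) 3 f)" .
  moreover have "real (card Z) * (B / card Z) = B" using \<open>Z \<noteq> {}\<close> Z(1) by simp
  ultimately show ?case unfolding B_def by (rule ord_eq_le_trans[OF sym, rotated])
qed

section \<open>Extremal functions\<close>

text \<open>
  The tensor product of \<open>u\<close>, a function of one letter, with \<open>f\<close>.\<close>

definition prepend :: "nat \<Rightarrow> (nat \<Rightarrow> real) \<Rightarrow> (nat list \<Rightarrow> real) \<Rightarrow> nat list \<Rightarrow> real" where
  "prepend q u f x = (case x of [] \<Rightarrow> 0 | a # y \<Rightarrow> if a < q then u a * f y else 0)"

lemma nbr_sum_prepend: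
  assumes f: "f \<in> weight_space n q l" and a: "a < q" and x: "x \<in> hamming_verts n q"
  shows "nbr_sum (Suc n) q (prepend q u f) (a # x) =
    (real n * (real q - 1) - real q * of_int l - 1) * (u a * f x) + (\<Sum>m<q. u m) * f x"
proof -
  have "nbr_sum (Suc n) q (prepend q u f) (a # x) =
      u a * nbr_sum n q f x + (\<Sum>m<q. u m) * f x - u a * f x"
    using nbr_sum_Cons[OF a x, of "prepend q u f"] a
    by (simp add: prepend_def nbr_sum_scale sum_distrib_right)
  then show ?thesis
    by (simp add: nbr_sum_weight_space[OF f x] algebra_simps)
qed

lemma prepend_in_vertex_funs:
  assumes "f \<in> weight_space n q l"
  shows "prepend q u f \<in> vertex_funs (Suc n) q"
  using assms
  by (auto simp: vertex_funs_def prepend_def Cons_in_hamming_verts weight_space_zero_outside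
      split: list.split)

lemma prepend_weight_space_sum_zero:
  assumes f: "f \<in> weight_space n q l" and u: "(\<Sum>m<q. u m) = 0"
  shows "prepend q u f \<in> weight_space (Suc n) q (l + 1)"
proof -
  have "nbr_sum (Suc n) q (prepend q u f) z =
      (real (Suc n) * (real q - 1) - real q * of_int (l + 1)) * prepend q u f z"
    if "z \<in> hamming_verts (Suc n) q" for z
    using that nbr_sum_prepend[OF f, of _ _ u] u
    by (auto simp: hamming_verts_Suc prepend_def algebra_simps)
  then show ?thesis
    using prepend_in_vertex_funs[OF f] by (simp add: weight_space_def)
qed

lemma prepend_weight_space_const:
  assumes f: "f \<in> weight_space n q l"
  shows "prepend q (\<lambda>m. c) f \<in> weight_space (Suc n) q l"
proof -
  have "nbr_sum (Suc n) q (prepend q (\<lambda>m. c) f) z =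
      (real (Suc n) * (real q - 1) - real q * of_int l) * prepend q (\<lambda>m. c) f z"
    if "z \<in> hamming_verts (Suc n) q" for z
    using that nbr_sum_prepend[OF f, of _ _ "\<lambda>m. c"]
    by (auto simp: hamming_verts_Suc prepend_def algebra_simps)
  then show ?thesis
    using prepend_in_vertex_funs[OF f] by (simp add: weight_space_def)
qed

lemma prepend_sum:
  "prepend q u (\<lambda>x. \<Sum>k\<in>K. g k x) x = (\<Sum>k\<in>K. prepend q u (g k) x)"
  by (auto simp: prepend_def sum_distrib_left split: list.split)

text \<open>
  The mean of \<open>u\<close> contributes weight 0, the remainder weight 1.\<close>

lemma prepend_spectral_sum:
  assumes f: "f \<in> spectral_sum n q {i..j}" and "q > 0"
  shows "prepend q u f \<in> spectral_sum (Suc n) q {i..j + 1}"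
proof -
  define mean where "mean = (\<Sum>m<q. u m) / real q"
  have "prepend q u f =
      (\<lambda>x. prepend q (\<lambda>m. mean) f x + prepend q (\<lambda>m. u m - mean) f x)"
    by (intro ext) (auto simp: prepend_def algebra_simps split: list.split)
  moreover have "prepend q (\<lambda>m. mean) f \<in> spectral_sum (Suc n) q {i..j}"
    using spectral_sum_map[OF f, of "prepend q (\<lambda>m. mean)" "Suc n" "\<lambda>k. k"]
    by (simp add: prepend_weight_space_const prepend_sum)
  then have "prepend q (\<lambda>m. mean) f \<in> spectral_sum (Suc n) q {i..j + 1}"
    using spectral_sum_mono[of "{i..j}" "{i..j + 1}"] by auto
  moreover have mean0: "(\<Sum>m<q. u m - mean) = 0"
    using \<open>q > 0\<close> by (simp add: sum_subtractf mean_def)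
  have "prepend q (\<lambda>m. u m - mean) f \<in> spectral_sum (Suc n) q ((\<lambda>k. k + 1) ` {i..j})"
    by (rule spectral_sum_map[OF f prepend_weight_space_sum_zero[OF _ mean0] prepend_sum])
       (auto simp: inj_def)
  then have "prepend q (\<lambda>m. u m - mean) f \<in> spectral_sum (Suc n) q {i..j + 1}"
    using spectral_sum_mono[of "(\<lambda>k. k + 1) ` {i..j}" "{i..j + 1}"] by auto
  ultimately show ?thesis using spectral_sum_add by simp
qed

lemma supp_size_scale:
  "supp_size n q (\<lambda>x. c * f x) = (if c = 0 then 0 else supp_size n q f)"
  by (simp add: supp_size_def)

lemma supp_size_prepend:
  "supp_size (Suc n) q (prepend q u f) = card {a. a < q \<and> u a \<noteq> 0} * supp_size n q f"
proof -
  have "supp_size (Suc n) q (prepend q u f) =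
      (\<Sum>a<q. if u a = 0 then 0 else supp_size n q f)"
    unfolding supp_size_Suc by (intro sum.cong refl) (simp add: prepend_def supp_size_scale)
  also have "\<dots> = (\<Sum>a\<in>{a. a < q \<and> u a \<noteq> 0}. supp_size n q f)"
    by (rule sum.mono_neutral_cong_right) auto
  finally show ?thesis by simp
qed

text \<open>
  On three letters the Vandermonde product is, up to the factor 2, the sign of a permutation and
  vanishes on words with a repeated letter; in particular it has six nonzero values.\<close>

definition vandermonde :: "nat \<Rightarrow> nat \<Rightarrow> nat \<Rightarrow> real" where
  "vandermonde a b c = (real b - real a) * (real c - real a) * (real c - real b)"

definition prepend_vandermonde :: "(nat list \<Rightarrow> real) \<Rightarrow> nat list \<Rightarrow> real" where
  "prepend_vandermonde f x = (case x of
     a # b # c # y \<Rightarrow> if a < 3 \<and> b < 3 \<and> c < 3 then vandermonde a b c * f y else 0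
   | _ \<Rightarrow> 0)"

text \<open>
  Changing one letter of a permutation repeats a letter, so each of the three sums has only the
  original term.  If exactly two letters agree, the only permutations among the neighbours arise by
  changing one or the other of these two to the missing letter, and they have opposite signs.  A
  constant word has no permutation as a neighbour.  As a result the neighbour
  sum of the Vandermonde product on \<open>H(3,3)\<close> is zero, which is the eigenvalue
  of weight 2.\<close>

lemma vandermonde_sums:
  assumes "a < 3" "b < 3" "c < 3"
  shows "(\<Sum>m<3. vandermonde m b c) + (\<Sum>m<3. vandermonde a m c) + (\<Sum>m<3. vandermonde a b m)
    = 3 * vandermonde a b c"
proof -
  have "a = 0 \<or> a = 1 \<or> a = 2" "b = 0 \<or> b = 1 \<or> b = 2" "c = 0 \<or> c = 1 \<or> c = 2"
    using assms by auto
  then show ?thesis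
    by (elim disjE) (simp_all add: vandermonde_def numeral_3_eq_3)
qed

lemma prepend_vandermonde_weight_space:
  assumes f: "f \<in> weight_space n 3 l"
  shows "prepend_vandermonde f \<in> weight_space (Suc (Suc (Suc n))) 3 (l + 2)"
proof -
  let ?F = "prepend_vandermonde f"
  have "nbr_sum (Suc (Suc (Suc n))) 3 ?F z =
      (real (Suc (Suc (Suc n))) * (real 3 - 1) - real 3 * of_int (l + 2)) * ?F z"
    if z: "z \<in> hamming_verts (Suc (Suc (Suc n))) 3" for z
  proof -
    obtain a b c x where zx: "z = a # b # c # x" and abc: "a < 3" "b < 3" "c < 3"
      and x: "x \<in> hamming_verts n 3"
      using z by (auto simp: hamming_verts_Suc)
    have F: "?F (a # b # c # y) = vandermonde a b c * f y"
      if "a < 3" "b < 3" "c < 3" for a b c y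
      using that by (simp add: prepend_vandermonde_def)
    have "nbr_sum (Suc (Suc (Suc n))) 3 ?F z =
        nbr_sum n 3 (\<lambda>y. ?F (a # b # c # y)) x
        + ((\<Sum>m<3. ?F (m # b # c # x)) + (\<Sum>m<3. ?F (a # m # c # x))
           + (\<Sum>m<3. ?F (a # b # m # x)) - 3 * ?F (a # b # c # x))"
      unfolding zx using abc x by (simp add: nbr_sum_Cons Cons_in_hamming_verts)
    also have "(\<Sum>m<3. ?F (m # b # c # x)) + (\<Sum>m<3. ?F (a # m # c # x))
        + (\<Sum>m<3. ?F (a # b # m # x)) =
        ((\<Sum>m<3. vandermonde m b c) + (\<Sum>m<3. vandermonde a m c)
          + (\<Sum>m<3. vandermonde a b m)) * f x"
      using abc by (simp add: F sum_distrib_right distrib_right)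
    also have "\<dots> = 3 * ?F (a # b # c # x)"
      using abc by (simp add: vandermonde_sums F)
    also have "nbr_sum n 3 (\<lambda>y. ?F (a # b # c # y)) x =
        (real n * (real 3 - 1) - real 3 * of_int l) * ?F z"
      using abc x by (simp add: zx F nbr_sum_scale nbr_sum_weight_space[OF f])
    finally show ?thesis by (simp add: algebra_simps)
  qed
  moreover have "?F \<in> vertex_funs (Suc (Suc (Suc n))) 3"
    using weight_space_zero_outside[OF f]
    by (auto simp: vertex_funs_def prepend_vandermonde_def Cons_in_hamming_verts split: list.split)
  ultimately show ?thesis by (simp add: weight_space_def)
qed

lemma supp_size_prepend_vandermonde:
  "supp_size (Suc (Suc (Suc n))) 3 (prepend_vandermonde f) = 6 * supp_size n 3 f"
  by (simp add: supp_size_Suc prepend_vandermonde_def numeral_3_eq_3 vandermonde_def supp_size_scale)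

lemma vandermonde_power:
  "\<exists>f \<in> weight_space (3 * d) 3 (2 * int d). supp_size (3 * d) 3 f = 6 ^ d"
proof (induction d)
  case 0
  have "(\<lambda>x. of_bool (x = [])) \<in> weight_space 0 3 0"
    by (auto simp: weight_space_def vertex_funs_def hamming_verts_0 nbr_sum_0)
  moreover have "supp_size 0 3 (\<lambda>x. of_bool (x = [])) = 1"
    by (simp add: supp_size_def hamming_verts_0 Collect_conv_if)
  ultimately show ?case by auto
next
  case (Suc d)
  then obtain f where f: "f \<in> weight_space (3 * d) 3 (2 * int d)" "supp_size (3 * d) 3 f = 6 ^ d"
    by blast
  have len: "3 * Suc d = Suc (Suc (Suc (3 * d)))" by simp
  show ?case
    unfolding len
    by (rule bexI[of _ "prepend_vandermonde f"])
       (use prepend_vandermonde_weight_space[OF f(1)] f(2) in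
         \<open>simp_all add: supp_size_prepend_vandermonde algebra_simps\<close>)
qed

lemma difference_powers:
  assumes "f \<in> weight_space n 3 l"
  shows "\<exists>h \<in> weight_space (n + e) 3 (l + int e). supp_size (n + e) 3 h = 2 ^ e * supp_size n 3 f"
proof (induction e)
  case 0
  then show ?case using assms by auto
next
  case (Suc e)
  then obtain h where h: "h \<in> weight_space (n + e) 3 (l + int e)"
    "supp_size (n + e) 3 h = 2 ^ e * supp_size n 3 f" by blast
  define u :: "nat \<Rightarrow> real" where "u a = of_bool (a = 0) - of_bool (a = 1)" for a
  have "(\<Sum>m<3. u m) = 0" by (simp add: u_def numeral_3_eq_3)
  then have "prepend 3 u h \<in> weight_space (n + Suc e) 3 (l + int (Suc e))"
    using prepend_weight_space_sum_zero[OF h(1)] by (simp add: algebra_simps)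
  moreover have "{a. a < 3 \<and> u a \<noteq> 0} = {0, 1}" by (auto simp: u_def)
  then have "supp_size (n + Suc e) 3 (prepend 3 u h) = 2 ^ Suc e * supp_size n 3 f"
    by (simp add: supp_size_prepend h(2))
  ultimately show ?case by blast
qed

lemma point_powers:
  assumes "f \<in> weight_space n 3 l"
  shows "\<exists>h \<in> spectral_sum (n + e) 3 {l..l + int e}. supp_size (n + e) 3 h = supp_size n 3 f"
proof (induction e)
  case 0
  then show ?case using assms by (auto simp: spectral_sum_singleton)
next
  case (Suc e)
  then obtain h where h: "h \<in> spectral_sum (n + e) 3 {l..l + int e}"
    "supp_size (n + e) 3 h = supp_size n 3 f" by blast
  define u :: "nat \<Rightarrow> real" where "u a = of_bool (a = 0)" for a
  have "prepend 3 u h \<in> spectral_sum (n + Suc e) 3 {l..l + int (Suc e)}"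
    using prepend_spectral_sum[OF h(1)] by (simp add: algebra_simps)
  moreover have "{a. a < 3 \<and> u a \<noteq> 0} = {0}" by (auto simp: u_def)
  then have "supp_size (n + Suc e) 3 (prepend 3 u h) = supp_size n 3 f"
    by (simp add: supp_size_prepend h(2))
  ultimately show ?case by blast
qed

text \<open>
  With \<open>d = n - j\<close> and \<open>e = i - 2 d\<close>, the hypothesis guarantees that \<open>e\<close> is not truncated, and the
  claimed minimum is \<open>2\<^sup>d\<^sup>+\<^sup>e 3\<^sup>d = 6\<^sup>d 2\<^sup>e\<close>.\<close>

theorem theorem6:
  fixes n i j :: nat
  assumes "n \<ge> 1"
    and "i \<le> j" and "j \<le> n"
    and "real i / 2 + real j > real n"
  shows "(\<forall>f \<in> hamming_eigensum n 3 i j.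
            f \<noteq> (\<lambda>x. 0) \<longrightarrow> supp_size n 3 f \<ge> 2 ^ (i + j - n) * 3 ^ (n - j)) \<and>
         (\<exists>f \<in> hamming_eigensum n 3 i j.
            f \<noteq> (\<lambda>x. 0) \<and> supp_size n 3 f = 2 ^ (i + j - n) * 3 ^ (n - j))"
proof -
  define d where "d = n - j"
  define e where "e = i - 2 * d"
  have ineq: "2 * n < i + 2 * j" using assms(4) by linarith
  have n: "n = j + d" and i: "i = 2 * d + e" and ij: "i + j - n = d + e"
    using assms(2,3) ineq by (auto simp: d_def e_def)
  have "2 ^ (d + e) * 3 ^ d \<le> supp_size n 3 f"
    if f: "f \<in> hamming_eigensum n 3 i j" "f \<noteq> (\<lambda>x. 0)" for f
  proof -
    have "real (2 ^ (d + e) * 3 ^ d) = 2 ^ (2 * d + e) * (3 / 2) ^ d"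
      by (simp add: power_add power_divide power_mult power2_eq_square mult_2)
    also have "\<dots> = 2 powi int i * (3 / 2) powi (int n - int j)"
      by (simp add: n i flip: power_int_of_nat)
    also have "\<dots> \<le> real (supp_size n 3 f)"
      using f by (intro supp_size_bound) (simp_all add: hamming_eigensum_eq_spectral_sum)
    finally show ?thesis by linarith
  qed
  moreover have "\<exists>f \<in> hamming_eigensum n 3 i j.
      f \<noteq> (\<lambda>x. 0) \<and> supp_size n 3 f = 2 ^ (d + e) * 3 ^ d"
  proof -
    obtain f0 where f0: "f0 \<in> weight_space (3 * d) 3 (2 * int d)" "supp_size (3 * d) 3 f0 = 6 ^ d"
      using vandermonde_power by blast
    obtain f1 where f1: "f1 \<in> weight_space (3 * d + e) 3 (2 * int d + int e)"
      "supp_size (3 * d + e) 3 f1 = 2 ^ e * 6 ^ d"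
      using difference_powers[OF f0(1), of e] f0(2) by auto
    obtain f where f: "f \<in> spectral_sum (3 * d + e + (j - i)) 3
        {2 * int d + int e..2 * int d + int e + int (j - i)}"
      "supp_size (3 * d + e + (j - i)) 3 f = 2 ^ e * 6 ^ d"
      using point_powers[OF f1(1), of "j - i"] f1(2) by auto
    have "3 * d + e + (j - i) = n" "2 * int d + int e = int i" "int i + int (j - i) = int j"
      using assms(2) n i by auto
    with f have "f \<in> hamming_eigensum n 3 i j" and size: "supp_size n 3 f = 2 ^ e * 6 ^ d"
      by (simp_all add: hamming_eigensum_eq_spectral_sum)
    moreover have "f \<noteq> (\<lambda>x. 0)" using size by (auto simp: supp_size_def)
    moreover have "2 ^ e * 6 ^ d = 2 ^ (d + e) * (3::nat) ^ d"
      by (simp add: power_add flip: power_mult_distrib)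
    ultimately show ?thesis by auto
  qed
  ultimately show ?thesis by (simp add: ij flip: d_def)
qed

end
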